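(* Let $E:\mathbb{R}^n\to\mathbb{R}$ be twice continuously differentiable with Hessian $G=\nabla\nabla E$, and let $x^*$ be a $k$-saddle of $E$ with $0<\mu\le\lambda_{\min}(|G(x^* )|)\le\lambda_{\max}(|G(x^* )|)\le L$. Suppose that for some $\delta,M>0$, $\|G(x)-G(y)\|_2\le M\|x-y\|_2$ for all $x,y\in U(x^*,\delta)$. Let $(x_m)_{m\ge0}$ be generated by the iHiSD iteration for a $k$-saddle (described in the context) with search direction $s\in\{\pm1\}$, ratios $\alpha_m\in[0,1]$ and step sizes $\eta_m$. Assume that for some $m_0$ and some $0<\varepsilon<1$, $\alpha_m\ge\frac{1+\varepsilon}{2}>\frac12$ for all $m\ge m_0$, and $$r_{m_0}=\|x_{m_0}-x^*\|_2<\min\left(\delta,\frac{2\mu\varepsilon}{3M}\right).$$ If $\eta_m=\frac{2}{L+\mu(2\alpha_m-1)}$ for all $m\ge m_0$, then $x_m$ converges to $x^*$ with linear convergence rate $\frac{\kappa+\varepsilon}{\kappa+3\varepsilon}$, where $\kappa=L/\mu$; that is, there is a constant $C\ge0$ such that $$\|x_m-x^*\|_2\le C\left(\frac{\kappa+\varepsilon}{\kappa+3\varepsilon}\right)^{m-m_0}\quad\text{for all } m\ge m_0.$$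
   Context: A $k$-saddle of $E$ is a point $x^*$ with $\nabla E(x^* )=0$ at which the Hessian has exactly $k$ negative eigenvalues (counted with multiplicity). For a symmetric matrix $A$, $|A|$ denotes the (positive semidefinite) square root of $A^2$. $U(x^*,\delta)$ is the open ball of radius $\delta$ about $x^*$. The iHiSD iteration for a $k$-saddle: given an initial state $x_0$, a search direction $s\in\{+1,-1\}$, a target index $k$, and sequences $(\alpha_m)$, $(\eta_m)$, at each step $m\ge0$ put $g_m=\nabla E(x_m)$, $G_m=G(x_m)$, let $v_{m,1},\dots,v_{m,k}$ be orthonormal eigenvectors of $G_m$ for its $k$ smallest eigenvalues (counted with multiplicity), and set $$d_m=\big((1-\alpha_m)s-\alpha_m\big)g_m+2\alpha_m\sum_{i=1}^k\langle v_{m,i},g_m\rangle v_{m,i},\qquad x_{m+1}=x_m+\eta_m d_m .$$ The iteration is considered without the stopping criterion (i.e. as an infinite sequence). *)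

theory Defs
  imports "HOL-Analysis.Analysis" "HOL-Computational_Algebra.Polynomial" "HOL-Library.Multiset"
begin

definition gradient :: "(real^'n \<Rightarrow> real) \<Rightarrow> real^'n \<Rightarrow> real^'n" where
  "gradient E x = (THE D. GDERIV E x :> D)"

definition hessian :: "(real^'n \<Rightarrow> real) \<Rightarrow> real^'n \<Rightarrow> real^'n^'n" where
  "hessian E x = jacobian (gradient E) (at x)"

definition twice_continuously_differentiable :: "(real^'n \<Rightarrow> real) \<Rightarrow> bool" where
  "twice_continuously_differentiable E \<longleftrightarrow>
     (\<forall>x. E differentiable (at x)) \<and>
     (\<forall>x. gradient E differentiable (at x)) \<and>
     continuous_on UNIV (hessian E)"

definition charpoly :: "real^'n^'n \<Rightarrow> real poly" where
  "charpoly A = det (mat [:0, 1:] - (\<chi> i j. [:A $ i $ j:]))"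

text \<open>
  The real eigenvalues, each repeated according to its algebraic multiplicity.  For a
  symmetric matrix, the only case used below, these are all the eigenvalues, and there are
  as many of them as the dimension.
\<close>
definition eigenvalues :: "real^'n^'n \<Rightarrow> real multiset" where
  "eigenvalues A = proots (charpoly A)"

definition lambda_min :: "real^'n^'n \<Rightarrow> real" where
  "lambda_min A = Min (set_mset (eigenvalues A))"

definition lambda_max :: "real^'n^'n \<Rightarrow> real" where
  "lambda_max A = Max (set_mset (eigenvalues A))"

definition positive_semidefinite :: "real^'n^'n \<Rightarrow> bool" where
  "positive_semidefinite B \<longleftrightarrow> transpose B = B \<and> (\<forall>v. 0 \<le> v \<bullet> (B *v v))"

text \<open>The absolute value of a symmetric matrix: the positive semidefinite square root of
  its square.\<close>
definition matrix_abs :: "real^'n^'n \<Rightarrow> real^'n^'n" where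
  "matrix_abs A = (THE B. positive_semidefinite B \<and> B ** B = A ** A)"

text \<open>The norm of the type \<^typ>\<open>real^'n^'n\<close> is the Frobenius norm; the matrix 2-norm is the
  operator norm with respect to the Euclidean norm.\<close>
definition matrix_norm2 :: "real^'n^'n \<Rightarrow> real" where
  "matrix_norm2 A = onorm (\<lambda>v. A *v v)"

definition k_saddle :: "nat \<Rightarrow> (real^'n \<Rightarrow> real) \<Rightarrow> real^'n \<Rightarrow> bool" where
  "k_saddle k E x \<longleftrightarrow>
     gradient E x = 0 \<and> size {#l \<in># eigenvalues (hessian E x). l < 0#} = k"

text \<open>
  The vectors \<open>v 0, \<dots>, v (k - 1)\<close> are orthonormal eigenvectors of \<open>A\<close> for its \<open>k\<close> smallest
  eigenvalues, listed in increasing order with multiplicity.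
\<close>
definition lowest_eigenvectors :: "real^'n^'n \<Rightarrow> nat \<Rightarrow> (nat \<Rightarrow> real^'n) \<Rightarrow> bool" where
  "lowest_eigenvectors A k v \<longleftrightarrow>
     (\<forall>i<k. \<forall>j<k. v i \<bullet> v j = (if i = j then 1 else 0)) \<and>
     (\<forall>i<k. A *v v i = (sorted_list_of_multiset (eigenvalues A) ! i) *\<^sub>R v i)"

definition ihisd_direction ::
  "(real^'n \<Rightarrow> real) \<Rightarrow> nat \<Rightarrow> real \<Rightarrow> real \<Rightarrow> (nat \<Rightarrow> real^'n) \<Rightarrow> real^'n \<Rightarrow> real^'n" where
  "ihisd_direction E k s a v x =
     ((1 - a) * s - a) *\<^sub>R gradient E x
       + (2 * a) *\<^sub>R (\<Sum>i<k. (v i \<bullet> gradient E x) *\<^sub>R v i)"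

text \<open>
  The sequence \<open>x\<close> is a run of the iteration.  The eigenvectors are not unique: each step may
  use any admissible choice.
\<close>
definition ihisd_iteration ::
  "(real^'n \<Rightarrow> real) \<Rightarrow> nat \<Rightarrow> real \<Rightarrow> (nat \<Rightarrow> real) \<Rightarrow> (nat \<Rightarrow> real) \<Rightarrow> (nat \<Rightarrow> real^'n) \<Rightarrow> bool" where
  "ihisd_iteration E k s \<alpha> \<eta> x \<longleftrightarrow>
     (\<forall>m. \<exists>v. lowest_eigenvectors (hessian E (x m)) k v \<and>
        x (Suc m) = x m + \<eta> m *\<^sub>R ihisd_direction E k s (\<alpha> m) v (x m))"

end

theory Submission
  imports Defs
begin

text \<open>Write \<open>\<beta> = 2 \<alpha> - 1\<close> and \<open>r = \<parallel>x - x\<^sup>*\<parallel>\<close>.  The search direction is a linear image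
  \<open>D (\<nabla>E x)\<close> of the gradient, where \<open>D\<close> acts as a scalar in \<open>[\<beta>, 1]\<close> on the span \<open>V\<close> of the
  chosen eigenvectors and as a scalar in \<open>[-1, -\<beta>]\<close> on its orthogonal complement.  If \<open>V\<close> is
  exactly the negative eigenspace of the Hessian \<open>G = G(x)\<close>, then \<open>- D G\<close> is positive definite,
  so the iteration behaves like gradient descent for the quadratic form of \<open>\<bar>D\<bar> \<bar>G\<bar>\<close>.

  Near the saddle \<open>V\<close> is indeed the negative eigenspace.  The Lipschitz condition gives
  \<open>\<parallel>G(x) - G(x\<^sup>*)\<parallel> \<le> M r < \<mu>\<close>, and a symmetric perturbation smaller than the gap \<open>\<mu>\<close> around \<open>0\<close>
  cannot change the number of negative eigenvalues (\<open>negative_eigenvalues_card_mono\<close>,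
  \<open>perturbed_eigenvalues\<close>).  Hence \<open>G(x)\<close> has exactly \<open>k\<close> negative eigenvalues, the \<open>k\<close> smallest
  ones are these, and any \<open>k\<close> orthonormal eigenvectors for them span the whole negative
  eigenspace (\<open>lowest_eigenvectors_projection\<close>); it does not matter which ones the iteration picks.

  The eigenvalues of \<open>\<bar>D\<bar> \<bar>G\<bar>\<close> lie in \<open>[\<beta> (\<mu> - M r), L + M r]\<close>.  The step size
  \<open>2 / (L + \<mu> \<beta>)\<close> balances the two ends of the unperturbed interval \<open>[\<mu> \<beta>, L]\<close>, so that
  \<open>I + \<eta> D G\<close> has norm at most \<open>(L - \<mu> \<beta> + 2 M r) / (L + \<mu> \<beta>)\<close> (\<open>balanced_step_contraction\<close>,
  \<open>ihisd_linear_step\<close>).  Replacing \<open>\<nabla>E x\<close> by \<open>G(x) (x - x\<^sup>*)\<close> costs \<open>M r\<^sup>2 / 2\<close>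
  (\<open>gradient_taylor_remainder\<close>), which adds \<open>M r / (L + \<mu> \<beta>)\<close> to this factor.  Together
  (\<open>ihisd_step_error\<close>), as \<open>\<beta> \<ge> \<epsilon>\<close>,
  \<open>r' \<le> (L - \<mu> \<epsilon> + 3 M r) / (L + \<mu> \<epsilon>) * r\<close>.

  The bound \<open>2 \<mu> \<epsilon> / (3 M)\<close> on the initial distance says precisely that this factor is below \<open>1\<close>
  at the start.  So \<open>r\<close> decreases to \<open>0\<close> and the factor tends to
  \<open>(L - \<mu> \<epsilon>) / (L + \<mu> \<epsilon>) = (\<kappa> - \<epsilon>) / (\<kappa> + \<epsilon>)\<close>, which is strictly smaller than
  \<open>(\<kappa> + \<epsilon>) / (\<kappa> + 3 \<epsilon>)\<close>.  The claimed rate therefore holds from some index on, and the finitely many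
  earlier steps are absorbed into the constant \<open>C\<close> (\<open>quadratically_perturbed_contraction\<close>).

  The linear algebra rests on the spectral theorem for real symmetric matrices, proved here by
  maximising the Rayleigh quotient; it applies to the Hessian because second derivatives commute
  (\<open>hessian_symmetric\<close>).\<close>

section \<open>Spectral theorem and absolute value of a symmetric matrix\<close>

text \<open>The basis is indexed by the type of matrix indices.  It therefore has the right number of
  vectors, and counting indices counts eigenvalues with multiplicity.\<close>
definition orthonormal_eigenbasis ::
  "real^'n^'n \<Rightarrow> ('n \<Rightarrow> real^'n) \<Rightarrow> ('n \<Rightarrow> real) \<Rightarrow> bool" where
  "orthonormal_eigenbasis A u l \<longleftrightarrow>
     (\<forall>i j. u i \<bullet> u j = (if i = j then 1 else 0)) \<and> (\<forall>i. A *v u i = l i *\<^sub>R u i)"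

lemma orthonormal_eigenbasisD:
  assumes "orthonormal_eigenbasis A u l"
  shows "u i \<bullet> u j = (if i = j then 1 else 0)" and "A *v u i = l i *\<^sub>R u i"
  using assms by (auto simp: orthonormal_eigenbasis_def)

lemma orthonormal_family_matrix:
  fixes u :: "'n \<Rightarrow> real^'n"
  assumes "\<And>i j. u i \<bullet> u j = (if i = j then 1 else 0)"
  shows "orthogonal_matrix (\<chi> i j. u j $ i)"
proof -
  have "transpose (\<chi> i j. u j $ i) ** (\<chi> i j. u j $ i) = (mat 1 :: real^'n^'n)"
    using assms by (simp add: vec_eq_iff matrix_matrix_mult_def transpose_def mat_def inner_vec_def)
  then show ?thesis by (simp add: orthogonal_matrix)
qed

text \<open>An orthonormal family of full size is the column family of an orthogonal matrix \<open>P\<close>, and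
  \<open>P P\<^sup>T = I\<close> is the expansion.\<close>
lemma orthonormal_expansion:
  fixes u :: "'n \<Rightarrow> real^'n"
  assumes "\<And>i j. u i \<bullet> u j = (if i = j then 1 else 0)"
  shows "x = (\<Sum>i\<in>UNIV. (u i \<bullet> x) *\<^sub>R u i)"
proof -
  let ?P = "(\<chi> i j. u j $ i) :: real^'n^'n"
  have "?P ** transpose ?P = mat 1"
    using orthonormal_family_matrix[OF assms] by (simp add: orthogonal_matrix_def)
  then have "x = ?P *v (transpose ?P *v x)"
    by (metis matrix_vector_mul_assoc matrix_vector_mul_lid)
  also have "\<dots> = (\<Sum>i\<in>UNIV. (u i \<bullet> x) *\<^sub>R u i)"
    by (simp add: vec_eq_iff matrix_vector_mult_def transpose_def inner_vec_def mult.commute del: transpose_matrix_vector)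
  finally show ?thesis .
qed

lemma orthonormal_parseval:
  fixes u :: "'n \<Rightarrow> real^'n"
  assumes "\<And>i j. u i \<bullet> u j = (if i = j then 1 else 0)"
  shows "x \<bullet> y = (\<Sum>i\<in>UNIV. (u i \<bullet> x) * (u i \<bullet> y))"
proof -
  have "x \<bullet> y = (\<Sum>i\<in>UNIV. (u i \<bullet> x) *\<^sub>R u i) \<bullet> y"
    using orthonormal_expansion[OF assms] by metis
  then show ?thesis by (simp add: inner_sum_left)
qed

lemma symmetric_matrix_inner:
  fixes A :: "real^'n^'n"
  assumes "transpose A = A"
  shows "x \<bullet> (A *v y) = (A *v x) \<bullet> y"
  by (metis assms dot_lmul_matrix vector_transpose_matrix)

text \<open>The eigenvector maximises the Rayleigh quotient on the unit sphere of \<open>S\<close>.  If the maximum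
  is \<open>c\<close>, then the residual \<open>z = A v - c v\<close> is a direction in \<open>S\<close> along which the quotient has
  slope \<open>2 \<parallel>z\<parallel>\<^sup>2\<close>, so it must vanish.\<close>
lemma symmetric_invariant_subspace_eigenvector:
  fixes A :: "real^'n^'n"
  assumes sym: "transpose A = A" and S: "subspace S" and inv: "\<And>x. x \<in> S \<Longrightarrow> A *v x \<in> S"
    and ne: "S \<noteq> {0}"
  obtains v c where "v \<in> S" "norm v = 1" "A *v v = c *\<^sub>R v"
proof -
  obtain y where y: "y \<in> S" "y \<noteq> 0" using S ne subspace_0 by auto
  let ?K = "S \<inter> sphere 0 1"
  have "y /\<^sub>R norm y \<in> ?K" using y S by (simp add: subspace_scale)
  then have "?K \<noteq> {}" by blast
  moreover have "compact ?K"
    using S by (simp add: closed_subspace compact_Int_closed Int_commute closed_Int_compact)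
  moreover have "continuous_on ?K (\<lambda>x. x \<bullet> (A *v x))"
    by (intro continuous_intros matrix_vector_mult_linear_continuous_on)
  ultimately obtain v where v: "v \<in> ?K" and vmax: "\<And>w. w \<in> ?K \<Longrightarrow> w \<bullet> (A *v w) \<le> v \<bullet> (A *v v)"
    using continuous_attains_sup[of ?K "\<lambda>x. x \<bullet> (A *v x)"] by blast
  define c where "c = v \<bullet> (A *v v)"
  have vv: "v \<bullet> v = 1" using v by (simp add: norm_eq_1)
  \<comment> \<open>By homogeneity the maximality of \<open>v\<close> extends from the sphere to all of \<open>S\<close>.\<close>
  have form: "w \<bullet> (A *v w) \<le> c * (w \<bullet> w)" if "w \<in> S" for w
  proof (cases "w = 0")
    case False
    have "w /\<^sub>R norm w \<in> ?K" using that S False by (simp add: subspace_scale)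
    from vmax[OF this] have "(w \<bullet> (A *v w)) / (norm w * norm w) \<le> c"
      by (simp add: c_def matrix_vector_mult_scaleR divide_inverse mult.commute mult.left_commute)
    then show ?thesis using False
      by (simp add: divide_le_eq power2_norm_eq_inner[symmetric] power2_eq_square)
  qed simp
  define z where "z = A *v v - c *\<^sub>R v"
  have zS: "z \<in> S" using v S inv by (auto simp: z_def subspace_diff subspace_scale)
  define q where "q = c * (z \<bullet> z) - z \<bullet> (A *v z)"
  have vz: "v \<bullet> z = 0" by (simp add: z_def inner_diff_right c_def vv)
  have zAv: "z \<bullet> (A *v v) = z \<bullet> z"
    using vz by (simp add: z_def inner_diff_right inner_diff_left inner_commute)
  \<comment> \<open>The inequality \<open>form\<close> at \<open>v + t z\<close> is an equality at \<open>t = 0\<close>; comparing the linear terms gives the bound.\<close>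
  have bound: "2 * (z \<bullet> z) \<le> t * q" if "t > 0" for t
  proof -
    have "v + t *\<^sub>R z \<in> S" using v zS S by (auto simp: subspace_add subspace_scale)
    from form[OF this] have "t * (2 * (z \<bullet> z)) \<le> t * (t * q)"
      using vz zAv symmetric_matrix_inner[OF sym, of v z]
      by (simp add: vv c_def[symmetric] q_def inner_commute algebra_simps)
    then show ?thesis using that by simp
  qed
  have "((\<lambda>t. t * q) \<longlongrightarrow> 0 * q) (at_right 0)"
    by (intro tendsto_intros)
  moreover have "\<forall>\<^sub>F t in at_right 0. 2 * (z \<bullet> z) \<le> t * q"
    using bound by (auto simp: eventually_at_filter)
  ultimately have "2 * (z \<bullet> z) \<le> 0"
    using tendsto_lowerbound[of "\<lambda>t. t * q" 0 "at_right 0"] by simp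
  then have "z = 0" using inner_gt_zero_iff[of z] by linarith
  then have "A *v v = c *\<^sub>R v" by (simp add: z_def)
  with v that show thesis by auto
qed

text \<open>The orthogonal complement of a set of eigenvectors of a symmetric matrix is invariant, so
  as long as it is not trivial it contains a further eigenvector.\<close>
lemma symmetric_orthonormal_eigenvectors:
  fixes A :: "real^'n^'n"
  assumes sym: "transpose A = A" and "d \<le> CARD('n)"
  shows "\<exists>B. finite B \<and> card B = d \<and> pairwise orthogonal B \<and>
           (\<forall>v\<in>B. norm v = 1 \<and> (\<exists>c. A *v v = c *\<^sub>R v))"
  using assms(2)
proof (induction d)
  case 0
  show ?case by (intro exI[of _ "{}"]) auto
next
  case (Suc d)
  then obtain B where B: "finite B" "card B = d" "pairwise orthogonal B"
      "\<And>v. v \<in> B \<Longrightarrow> norm v = 1" "\<And>v. v \<in> B \<Longrightarrow> \<exists>c. A *v v = c *\<^sub>R v"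
    by auto
  let ?S = "{y. \<forall>v\<in>B. orthogonal v y}"
  have "dim B < DIM(real^'n)"
    using B Suc.prems dim_le_card'[of B] by simp
  then obtain y where "y \<noteq> 0" "\<And>w. w \<in> span B \<Longrightarrow> orthogonal y w"
    using orthogonal_to_subspace_exists by blast
  then have ne: "?S \<noteq> {0}" by (auto simp: orthogonal_commute span_base)
  have inv: "A *v x \<in> ?S" if "x \<in> ?S" for x
  proof (clarify)
    fix v assume v: "v \<in> B"
    then obtain c where "A *v v = c *\<^sub>R v" using B by blast
    then have "v \<bullet> (A *v x) = c * (v \<bullet> x)"
      by (simp add: symmetric_matrix_inner[OF sym])
    then show "orthogonal v (A *v x)" using that v by (simp add: orthogonal_def)
  qed
  obtain v c where v: "v \<in> ?S" "norm v = 1" "A *v v = c *\<^sub>R v"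
    using symmetric_invariant_subspace_eigenvector[OF sym subspace_orthogonal_to_vectors inv ne] by blast
  then have "v \<notin> B" by (auto simp: orthogonal_def)
  with B v show ?case
    by (intro exI[of _ "insert v B"]) (auto simp: pairwise_insert orthogonal_commute)
qed

theorem symmetric_orthonormal_eigenbasis:
  fixes A :: "real^'n^'n"
  assumes "transpose A = A"
  obtains u l where "orthonormal_eigenbasis A u l"
proof -
  obtain B where B: "finite B" "card B = CARD('n)" "pairwise orthogonal B"
      "\<And>v. v \<in> B \<Longrightarrow> norm v = 1" "\<And>v. v \<in> B \<Longrightarrow> \<exists>c. A *v v = c *\<^sub>R v"
    using symmetric_orthonormal_eigenvectors[OF assms, of "CARD('n)"] by auto
  then obtain u :: "'n \<Rightarrow> real^'n" where u: "bij_betw u UNIV B"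
    using finite_same_card_bij[of "UNIV :: 'n set" B] by auto
  then have uB: "u i \<in> B" for i by (auto simp: bij_betw_def)
  from u have inj: "u i = u j \<longleftrightarrow> i = j" for i j by (auto simp: bij_betw_def inj_on_def)
  have "\<forall>i. \<exists>c. A *v u i = c *\<^sub>R u i" using B(5) uB by blast
  then obtain l where l: "\<And>i. A *v u i = l i *\<^sub>R u i" by (auto dest!: choice)
  have "u i \<bullet> u j = (if i = j then 1 else 0)" for i j
    using B(3,4) uB[of i] uB[of j] inj[of i j]
    by (auto simp: pairwise_def orthogonal_def norm_eq_1)
  with l have "orthonormal_eigenbasis A u l" by (simp add: orthonormal_eigenbasis_def)
  then show thesis by (rule that)
qed

text \<open>Over the polynomial ring, the matrix \<open>P\<close> of constant polynomials whose columns are the basis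
  vectors satisfies \<open>(X I - A) P = P diag(X - l\<^sub>i)\<close>; its determinant cancels because its square is
  \<open>1\<close>.\<close>
lemma charpoly_eigenbasis:
  fixes A :: "real^'n^'n"
  assumes "orthonormal_eigenbasis A u l"
  shows "charpoly A = (\<Prod>i\<in>UNIV. [:- l i, 1:])"
proof -
  note u = orthonormal_eigenbasisD[OF assms]
  let ?P = "(\<chi> i j. [:u j $ i:]) :: real poly^'n^'n"
  let ?M = "mat [:0, 1:] - (\<chi> i j. [:A $ i $ j:]) :: real poly^'n^'n"
  let ?D = "(\<chi> i j. if i = j then [:- l i, 1:] else 0) :: real poly^'n^'n"
  have "(\<Sum>k\<in>UNIV. [:u i $ k:] * [:u j $ k:]) = (if i = j then 1 else 0)" for i j
  proof -
    have "(\<Sum>k\<in>UNIV. u i $ k * u j $ k) = (if i = j then 1 else 0)"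
      using u(1)[of i j] by (simp only: inner_vec_def inner_real_def)
    moreover have "(\<Sum>k\<in>UNIV. [:u i $ k:] * [:u j $ k:]) = [:\<Sum>k\<in>UNIV. u i $ k * u j $ k:]"
      unfolding sum_to_poly[symmetric] by (rule sum.cong) auto
    ultimately show ?thesis by simp
  qed
  then have "transpose ?P ** ?P = mat 1"
    by (simp add: vec_eq_iff matrix_matrix_mult_def transpose_def mat_def)
  then have "det (transpose ?P ** ?P) = 1" by simp
  then have "det ?P * det ?P = 1" by (simp add: det_mul)
  then have nz: "det ?P \<noteq> 0" by auto
  have Au: "(\<Sum>k\<in>UNIV. A $ i $ k * u j $ k) = l j * u j $ i" for i j
    using u(2)[of j] by (simp add: vec_eq_iff matrix_vector_mult_def)
  have "?M ** ?P = ?P ** ?D"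
  proof -
    have "(\<Sum>k\<in>UNIV. ((if i = k then [:0, 1:] else 0) - [:A $ i $ k:]) * [:u j $ k:])
        = [:- l j * u j $ i, u j $ i:]" for i j
    proof -
      have "(\<Sum>k\<in>UNIV. ((if i = k then [:0, 1:] else 0) - [:A $ i $ k:]) * [:u j $ k:])
        = (\<Sum>k\<in>UNIV. (if i = k then [:0, 1:] * [:u j $ k:] else 0)) - (\<Sum>k\<in>UNIV. [:A $ i $ k * u j $ k:])"
        unfolding sum_subtractf[symmetric] by (rule sum.cong) (auto simp: left_diff_distrib)
      also have "\<dots> = [:- l j * u j $ i, u j $ i:]"
        by (simp add: sum_to_poly Au)
      finally show ?thesis .
    qed
    moreover have "(\<Sum>k\<in>UNIV. [:u k $ i:] * (if k = j then [:- l k, 1:] else 0))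
       = [:- l j * u j $ i, u j $ i:]" for i j
    proof -
      have "(\<Sum>k\<in>UNIV. [:u k $ i:] * (if k = j then [:- l k, 1:] else 0))
        = (\<Sum>k\<in>UNIV. if k = j then [:u k $ i:] * [:- l k, 1:] else 0)"
        by (rule sum.cong) auto
      then show ?thesis by (simp add: mult.commute)
    qed
    ultimately show ?thesis
      by (simp add: vec_eq_iff matrix_matrix_mult_def mat_def)
  qed
  then have "det (?M ** ?P) = det (?P ** ?D)" by simp
  then have "det ?M * det ?P = det ?P * det ?D" by (simp only: det_mul)
  with nz have "det ?M = det ?D" by simp
  also have "\<dots> = (\<Prod>i\<in>UNIV. [:- l i, 1:])" by (subst det_diagonal) auto
  finally show ?thesis by (simp add: charpoly_def)
qed

lemma eigenvalues_eigenbasis: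
  assumes "orthonormal_eigenbasis A u l"
  shows "eigenvalues A = image_mset l (mset_set UNIV)"
proof -
  have "eigenvalues A = (\<Sum>i\<in>UNIV. {#l i#})"
    by (simp add: eigenvalues_def charpoly_eigenbasis[OF assms] proots_prod)
  also have "\<dots> = (\<Sum>i\<in>#mset_set UNIV. {#l i#})" by (simp only: sum_unfold_sum_mset)
  also have "\<dots> = image_mset l (mset_set UNIV)" by (rule sum_mset_singleton_mset)
  finally show ?thesis .
qed

lemma matrix_eq_on_orthonormal:
  fixes A B :: "real^'n^'n" and u :: "'n \<Rightarrow> real^'n"
  assumes u: "\<And>i j. u i \<bullet> u j = (if i = j then 1 else 0)" and eq: "\<And>i. A *v u i = B *v u i"
  shows "A = B"
proof -
  have "A *v x = B *v x" for x
  proof -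
    have "A *v x = A *v (\<Sum>i\<in>UNIV. (u i \<bullet> x) *\<^sub>R u i)"
      by (metis orthonormal_expansion[OF u])
    also have "\<dots> = B *v (\<Sum>i\<in>UNIV. (u i \<bullet> x) *\<^sub>R u i)"
      by (simp add: linear_sum[OF matrix_vector_mul_linear] matrix_vector_mult_scaleR eq)
    also have "\<dots> = B *v x"
      by (metis orthonormal_expansion[OF u])
    finally show ?thesis .
  qed
  then show ?thesis by (simp add: matrix_eq)
qed

text \<open>Both roots agree on an eigenbasis of \<open>B\<close>.  For \<open>B w = b w\<close> the vector \<open>z = C w - b w\<close> satisfies
  \<open>C z = - b z\<close>, since \<open>C\<^sup>2 w = b\<^sup>2 w\<close>.  As \<open>C\<close> is positive semidefinite, this forces \<open>z = 0\<close>
  or \<open>b = 0\<close>, and in the latter case \<open>\<parallel>C w\<parallel>\<^sup>2 = w \<bullet> C\<^sup>2 w = 0\<close>.\<close>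
lemma positive_semidefinite_sqrt_unique:
  fixes B C :: "real^'n^'n"
  assumes B: "positive_semidefinite B" and C: "positive_semidefinite C" and eq: "B ** B = C ** C"
  shows "B = C"
proof -
  from B obtain w b where wb: "orthonormal_eigenbasis B w b"
    using symmetric_orthonormal_eigenbasis by (auto simp: positive_semidefinite_def)
  note w = orthonormal_eigenbasisD[OF wb]
  have symC: "transpose C = C" using C by (simp add: positive_semidefinite_def)
  have CB: "C *v (C *v x) = B *v (B *v x)" for x
    by (simp add: matrix_vector_mul_assoc eq)
  have "B *v w i = C *v w i" for i
  proof -
    have "0 \<le> w i \<bullet> (B *v w i)" using B by (simp add: positive_semidefinite_def)
    then have b: "0 \<le> b i" by (simp add: w)
    have CC: "C *v (C *v w i) = (b i * b i) *\<^sub>R w i"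
      by (simp add: CB w matrix_vector_mult_scaleR)
    define z where "z = C *v w i - b i *\<^sub>R w i"
    have Cz: "C *v z = - b i *\<^sub>R z"
      by (simp add: z_def matrix_vector_mult_diff_distrib matrix_vector_mult_scaleR CC
          scaleR_diff_right)
    have "0 \<le> z \<bullet> (C *v z)" using C by (simp add: positive_semidefinite_def)
    then have "b i * (z \<bullet> z) \<le> 0" by (simp add: Cz)
    then consider "b i = 0" | "z = 0"
      using b by (cases "b i = 0") (auto simp: mult_le_0_iff simp flip: power2_norm_eq_inner)
    then show ?thesis
    proof cases
      case 1
      then have "(C *v w i) \<bullet> (C *v w i) = 0"
        using CC symmetric_matrix_inner[OF symC, of "w i" "C *v w i"] by simp
      then show ?thesis using 1 by (simp add: w)
    next
      case 2
      then show ?thesis by (simp add: z_def w)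
    qed
  qed
  then show ?thesis by (rule matrix_eq_on_orthonormal[OF w(1)])
qed

lemma matrix_abs_eigenbasis:
  fixes A :: "real^'n^'n"
  assumes ul: "orthonormal_eigenbasis A u l"
  shows "orthonormal_eigenbasis (matrix_abs A) u (\<lambda>i. \<bar>l i\<bar>)"
proof -
  note u = orthonormal_eigenbasisD[OF ul]
  \<comment> \<open>This is \<open>\<Sum>\<^sub>i \<bar>l\<^sub>i\<bar> u\<^sub>i u\<^sub>i\<^sup>T\<close>; by uniqueness of the root it is \<open>\<bar>A\<bar>\<close>.\<close>
  define B :: "real^'n^'n" where "B = (\<chi> a b. \<Sum>i\<in>UNIV. \<bar>l i\<bar> * (u i $ a * u i $ b))"
  have Bx: "B *v x = (\<Sum>i\<in>UNIV. (\<bar>l i\<bar> * (u i \<bullet> x)) *\<^sub>R u i)" for x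
  proof -
    have "(\<Sum>b\<in>UNIV. (\<Sum>i\<in>UNIV. \<bar>l i\<bar> * (u i $ a * u i $ b)) * x $ b)
        = (\<Sum>i\<in>UNIV. \<bar>l i\<bar> * (\<Sum>b\<in>UNIV. u i $ b * x $ b) * u i $ a)" for a
      by (subst sum_distrib_right, subst sum.swap)
        (simp add: sum_distrib_left sum_distrib_right mult_ac)
    then show ?thesis
      by (simp add: vec_eq_iff matrix_vector_mult_def B_def inner_vec_def)
  qed
  have Bu: "B *v u j = \<bar>l j\<bar> *\<^sub>R u j" for j
  proof -
    have "B *v u j = (\<Sum>i\<in>UNIV. (if i = j then \<bar>l j\<bar> *\<^sub>R u j else 0))"
      unfolding Bx by (rule sum.cong) (auto simp: u)
    then show ?thesis by simp
  qed
  have "transpose B = B" by (simp add: B_def transpose_def vec_eq_iff mult.commute)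
  moreover have "0 \<le> v \<bullet> (B *v v)" for v
    by (simp add: Bx inner_sum_right inner_commute[of v] mult.assoc sum_nonneg)
  ultimately have psd: "positive_semidefinite B" by (simp add: positive_semidefinite_def)
  have "(B ** B) *v u i = (A ** A) *v u i" for i
    by (simp add: Bu u matrix_vector_mult_scaleR flip: matrix_vector_mul_assoc)
  then have sq: "B ** B = A ** A" by (rule matrix_eq_on_orthonormal[OF u(1)])
  have "matrix_abs A = B"
    unfolding matrix_abs_def
    by (rule the_equality) (auto simp: psd sq intro: positive_semidefinite_sqrt_unique[OF _ psd])
  then show ?thesis by (simp add: orthonormal_eigenbasis_def u Bu)
qed

text \<open>This is how the hypotheses on \<open>\<bar>G(x\<^sup>*)\<bar>\<close> are used: they say that the spectrum of the Hessian
  at the saddle avoids \<open>(-\<mu>, \<mu>)\<close> and lies in \<open>[-L, L]\<close>.\<close>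
lemma eigenbasis_abs_bounds:
  fixes A :: "real^'n^'n"
  assumes ul: "orthonormal_eigenbasis A u l"
  shows "lambda_min (matrix_abs A) \<le> \<bar>l i\<bar>" and "\<bar>l i\<bar> \<le> lambda_max (matrix_abs A)"
  by (simp_all add: lambda_min_def lambda_max_def eigenvalues_eigenbasis[OF matrix_abs_eigenbasis[OF ul]])

lemma eigenbasis_coordinate:
  fixes A :: "real^'n^'n"
  assumes sym: "transpose A = A" and ul: "orthonormal_eigenbasis A u l"
  shows "u i \<bullet> (A *v x) = l i * (u i \<bullet> x)"
  by (simp add: symmetric_matrix_inner[OF sym] orthonormal_eigenbasisD[OF ul])

lemma eigenbasis_quadratic_form:
  fixes A :: "real^'n^'n"
  assumes sym: "transpose A = A" and ul: "orthonormal_eigenbasis A u l"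
  shows "x \<bullet> (A *v x) = (\<Sum>i\<in>UNIV. l i * (u i \<bullet> x)\<^sup>2)"
  by (subst orthonormal_parseval[OF orthonormal_eigenbasisD(1)[OF ul]])
    (simp add: eigenbasis_coordinate[OF sym ul] power2_eq_square mult_ac)

lemma norm_le_by_coordinates:
  fixes w :: "'n \<Rightarrow> real^'n"
  assumes w: "\<And>i j. w i \<bullet> w j = (if i = j then 1 else 0)"
    and le: "\<And>i. \<bar>w i \<bullet> y\<bar> \<le> q * \<bar>w i \<bullet> x\<bar>" and "0 \<le> q"
  shows "norm y \<le> q * norm x"
proof -
  have "(w i \<bullet> y)\<^sup>2 \<le> q\<^sup>2 * (w i \<bullet> x)\<^sup>2" for i
    using power_mono[OF le[of i], of 2] by (simp add: power_mult_distrib)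
  then have "y \<bullet> y \<le> q\<^sup>2 * (x \<bullet> x)"
    unfolding orthonormal_parseval[OF w, of x x] orthonormal_parseval[OF w, of y y]
    by (auto simp: sum_distrib_left power2_eq_square intro!: sum_mono)
  then have "(norm y)\<^sup>2 \<le> (q * norm x)\<^sup>2"
    by (simp add: power2_norm_eq_inner power_mult_distrib)
  then show ?thesis using \<open>0 \<le> q\<close> by (simp add: power2_le_iff_abs_le)
qed

lemma orthonormal_span_orthogonal:
  fixes u :: "'n \<Rightarrow> 'a::real_inner"
  assumes u: "\<And>i j. u i \<bullet> u j = (if i = j then 1 else 0)" and "x \<in> span (u ` N)" "j \<notin> N"
  shows "u j \<bullet> x = 0"
proof -
  have "orthogonal (u j) y" if "y \<in> u ` N" for y
    using that \<open>j \<notin> N\<close> by (auto simp: orthogonal_def u)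
  then show ?thesis using orthogonal_to_span[OF assms(2)] by (simp add: orthogonal_def)
qed

lemma orthonormal_independent_inj:
  fixes u :: "'n \<Rightarrow> 'a::euclidean_space"
  assumes u: "\<And>i j. i \<in> N \<Longrightarrow> j \<in> N \<Longrightarrow> u i \<bullet> u j = (if i = j then 1 else 0)"
  shows "independent (u ` N)" and "inj_on u N"
proof -
  show inj: "inj_on u N" 
  proof (rule inj_onI)
    fix i j assume "i \<in> N" "j \<in> N" "u i = u j"
    then show "i = j" using u[of i j] u[of i i] by (auto split: if_splits)
  qed
  have "pairwise orthogonal (u ` N)" using u by (auto simp: pairwise_def orthogonal_def)
  moreover have "0 \<notin> u ` N" using u by fastforce
  ultimately show "independent (u ` N)" by (rule pairwise_orthogonal_independent)
qed

section \<open>Eigenvalues under perturbation and the span of the lowest eigenvectors\<close>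

text \<open>If \<open>B\<close> had fewer negative eigenvalues than \<open>A\<close>, then by dimension the negative eigenspace of
  \<open>A\<close> would meet the nonnegative eigenspace of \<open>B\<close> in some \<open>x \<noteq> 0\<close>.  There the form of \<open>A\<close> is at
  most \<open>- \<mu> \<parallel>x\<parallel>\<^sup>2\<close> and that of \<open>B\<close> is at least \<open>0\<close>, which a perturbation of size \<open>r < \<mu>\<close> does not
  allow.  Only \<open>A\<close> has the full gap \<open>\<mu>\<close>.  Exchanging \<open>A\<close> and \<open>B\<close> would need \<open>2 r < \<mu>\<close>, so
  the reverse inequality is derived from the count of positive eigenvalues, by passing to
  \<open>-A\<close> and \<open>-B\<close>.\<close>
lemma negative_eigenvalues_card_mono:
  fixes A B :: "real^'n^'n"
  assumes symA: "transpose A = A" and ul: "orthonormal_eigenbasis A u l"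
    and symB: "transpose B = B" and wb: "orthonormal_eigenbasis B w b"
    and gap: "\<And>i. l i < 0 \<Longrightarrow> l i \<le> - \<mu>" and "r < \<mu>"
    and close: "\<And>x. x \<bullet> (B *v x) \<le> x \<bullet> (A *v x) + r * (x \<bullet> x)"
  shows "card {i. l i < 0} \<le> card {i. b i < 0}"
proof (rule ccontr)
  assume less: "\<not> ?thesis"
  let ?N = "{i. l i < 0}" and ?P = "{i. \<not> b i < 0}"
  note u = orthonormal_eigenbasisD(1)[OF ul] and w = orthonormal_eigenbasisD(1)[OF wb]
  have dimN: "dim (span (u ` ?N)) = card ?N"
    using orthonormal_independent_inj[of ?N u] u by (simp add: dim_eq_card_independent card_image)
  have dimP: "dim (span (w ` ?P)) = card ?P"
    using orthonormal_independent_inj[of ?P w] w by (simp add: dim_eq_card_independent card_image)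
  have "card {i. b i < 0} + card ?P = CARD('n)"
  proof -
    have "?P = UNIV - {i. b i < 0}" by auto
    then show ?thesis by (simp add: card_Diff_subset card_mono)
  qed
  with less have "dim (span (u ` ?N)) + dim (span (w ` ?P)) > CARD('n)"
    by (simp only: dimN dimP)
  moreover have "dim {x + y |x y. x \<in> span (u ` ?N) \<and> y \<in> span (w ` ?P)} \<le> CARD('n)"
    using dim_subset_UNIV_cart by blast
  ultimately have "dim (span (u ` ?N) \<inter> span (w ` ?P)) > 0"
    using dim_sums_Int[OF subspace_span[of "u ` ?N"] subspace_span[of "w ` ?P"]] by linarith
  then have "\<not> span (u ` ?N) \<inter> span (w ` ?P) \<subseteq> {0}"
    using dim_eq_0[of "span (u ` ?N) \<inter> span (w ` ?P)"] by linarith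
  then obtain x where x: "x \<in> span (u ` ?N)" "x \<in> span (w ` ?P)" "x \<noteq> 0"
    by blast
  have "x \<bullet> (A *v x) = (\<Sum>i\<in>UNIV. l i * (u i \<bullet> x)\<^sup>2)"
    by (rule eigenbasis_quadratic_form[OF symA ul])
  also have "\<dots> \<le> (\<Sum>i\<in>UNIV. - \<mu> * (u i \<bullet> x)\<^sup>2)"
  proof (rule sum_mono)
    fix i
    show "l i * (u i \<bullet> x)\<^sup>2 \<le> - \<mu> * (u i \<bullet> x)\<^sup>2"
    proof (cases "l i < 0")
      case True
      then show ?thesis using gap by (intro mult_right_mono) auto
    next
      case False
      then show ?thesis using orthonormal_span_orthogonal[OF u x(1), of i] by simp
    qed
  qed
  also have "\<dots> = - \<mu> * (x \<bullet> x)"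
    using orthonormal_parseval[OF u, of x x] by (simp add: sum_distrib_left power2_eq_square)
  finally have "x \<bullet> (A *v x) \<le> - \<mu> * (x \<bullet> x)" .
  moreover have "0 \<le> x \<bullet> (B *v x)"
    unfolding eigenbasis_quadratic_form[OF symB wb]
  proof (rule sum_nonneg)
    fix i
    show "0 \<le> b i * (w i \<bullet> x)\<^sup>2"
      using orthonormal_span_orthogonal[OF w x(2), of i] by (cases "b i < 0") auto
  qed
  ultimately have "(\<mu> - r) * (x \<bullet> x) \<le> 0"
    using close[of x] by (simp add: algebra_simps)
  then show False using \<open>r < \<mu>\<close> x(3)
    by (auto simp: mult_le_0_iff simp flip: power2_norm_eq_inner)
qed

lemma minus_matrix_vector_mult:
  fixes A :: "'a::ring_1^'n^'m"
  shows "(- A) *v x = - (A *v x)"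
  by (simp add: vec_eq_iff matrix_vector_mult_def sum_negf)

lemma orthonormal_eigenbasis_uminus:
  assumes "orthonormal_eigenbasis A u l"
  shows "orthonormal_eigenbasis (- A) u (\<lambda>i. - l i)"
  using assms by (simp add: orthonormal_eigenbasis_def minus_matrix_vector_mult)

text \<open>The bounds come from \<open>\<bar>b\<^sub>i\<bar> = \<parallel>B w\<^sub>i\<parallel>\<close> and \<open>\<mu> \<le> \<parallel>A w\<^sub>i\<parallel> \<le> L\<close>.  For the count, neither the negative
  nor the positive eigenvalues of \<open>A\<close> can decrease in number, and those of \<open>A\<close> already
  account for the full dimension.\<close>
lemma perturbed_eigenvalues:
  fixes A B :: "real^'n^'n"
  assumes symA: "transpose A = A" and ul: "orthonormal_eigenbasis A u l"
    and symB: "transpose B = B" and wb: "orthonormal_eigenbasis B w b"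
    and bounds: "\<And>i. \<mu> \<le> \<bar>l i\<bar>" "\<And>i. \<bar>l i\<bar> \<le> L"
    and close: "\<And>x. norm (B *v x - A *v x) \<le> r * norm x" and "0 \<le> r" "r < \<mu>"
  shows "\<mu> - r \<le> \<bar>b i\<bar>" and "\<bar>b i\<bar> \<le> L + r"
    and "card {i. b i < 0} = card {i. l i < 0}"
proof -
  note u = orthonormal_eigenbasisD[OF ul] and w = orthonormal_eigenbasisD[OF wb]
  have \<mu>: "0 < \<mu>" using \<open>0 \<le> r\<close> \<open>r < \<mu>\<close> by simp
  have L: "0 \<le> L" using bounds(2) by (meson abs_ge_zero order_trans)
  have nw: "norm (w i) = 1" for i by (simp add: norm_eq_1 w)
  have nB: "norm (B *v w i) = \<bar>b i\<bar>" for i by (simp add: w nw)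
  have "norm (A *v w i) \<le> L * norm (w i)"
    by (rule norm_le_by_coordinates[OF u(1)])
      (auto simp: eigenbasis_coordinate[OF symA ul] abs_mult bounds L intro!: mult_right_mono)
  moreover have "norm (\<mu> *\<^sub>R w i) \<le> 1 * norm (A *v w i)"
    by (rule norm_le_by_coordinates[OF u(1)])
      (use \<mu> in \<open>auto simp: eigenbasis_coordinate[OF symA ul] abs_mult bounds intro!: mult_right_mono\<close>)
  ultimately show "\<mu> - r \<le> \<bar>b i\<bar>" and "\<bar>b i\<bar> \<le> L + r"
    using close[of "w i"] nB[of i] nw[of i] \<mu>
      norm_triangle_ineq2[of "B *v w i" "A *v w i"] norm_triangle_ineq3[of "B *v w i" "A *v w i"]
    by auto
  have form: "\<bar>x \<bullet> (B *v x) - x \<bullet> (A *v x)\<bar> \<le> r * (x \<bullet> x)" for x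
  proof -
    have "\<bar>x \<bullet> (B *v x - A *v x)\<bar> \<le> norm x * norm (B *v x - A *v x)"
      by (rule Cauchy_Schwarz_ineq2)
    also have "\<dots> \<le> norm x * (r * norm x)"
      using close by (rule mult_left_mono) simp
    finally show ?thesis
      by (simp add: inner_diff_right power2_norm_eq_inner[symmetric] power2_eq_square mult_ac)
  qed
  have tminus: "transpose (- C) = - transpose C" for C :: "real^'n^'n"
    by (simp add: vec_eq_iff transpose_def)
  have neg: "card {i. l i < 0} \<le> card {i. b i < 0}"
  proof (rule negative_eigenvalues_card_mono[OF symA ul symB wb _ \<open>r < \<mu>\<close>])
    fix i assume "l i < 0"
    then show "l i \<le> - \<mu>" using bounds(1)[of i] by simp
  next
    fix x show "x \<bullet> (B *v x) \<le> x \<bullet> (A *v x) + r * (x \<bullet> x)" using form[of x] by linarith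
  qed
  \<comment> \<open>The positive eigenvalues of \<open>A\<close> and \<open>B\<close> are the negative ones of \<open>-A\<close> and \<open>-B\<close>.\<close>
  have pos: "card {i. - l i < 0} \<le> card {i. - b i < 0}"
  proof (rule negative_eigenvalues_card_mono[OF _ orthonormal_eigenbasis_uminus[OF ul]
        _ orthonormal_eigenbasis_uminus[OF wb] _ \<open>r < \<mu>\<close>])
    fix i assume "- l i < 0"
    then show "- l i \<le> - \<mu>" using bounds(1)[of i] by simp
  next
    fix x show "x \<bullet> (- B *v x) \<le> x \<bullet> (- A *v x) + r * (x \<bullet> x)"
      using form[of x] by (simp add: minus_matrix_vector_mult)
  qed (simp_all add: tminus symA symB)
  have total: "card {i. c i < 0} + card {i. - c i < 0} \<le> CARD('n)" for c :: "'n \<Rightarrow> real"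
    by (subst card_Un_disjoint[symmetric]) (auto intro: card_mono)
  have "l i \<noteq> 0" for i using bounds(1)[of i] \<mu> by auto
  then have "{i. l i < 0} \<union> {i. - l i < 0} = UNIV" by (auto simp: not_less less_le)
  then have "CARD('n) = card ({i. l i < 0} \<union> {i. - l i < 0})" by simp
  also have "\<dots> = card {i. l i < 0} + card {i. - l i < 0}"
    by (rule card_Un_disjoint) auto
  finally show "card {i. b i < 0} = card {i. l i < 0}"
    using neg pos total[of b] by linarith
qed

text \<open>Applied to a spectrum: if exactly \<open>k\<close> eigenvalues are negative, then the \<open>k\<close> smallest
  ones are.  A nonnegative element at position \<open>j\<close> of the sorted list would leave room for at most
  \<open>j < k\<close> negative ones.\<close>
lemma sorted_nth_negative:
  fixes M :: "real multiset"
  assumes "size {#x \<in># M. x < 0#} = k" "j < k"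
  shows "sorted_list_of_multiset M ! j < 0"
proof (rule ccontr)
  let ?ls = "sorted_list_of_multiset M"
  assume "\<not> ?ls ! j < 0"
  have "length (filter (\<lambda>x. x < 0) ?ls) = k"
    using assms(1) by (metis mset_filter mset_sorted_list_of_multiset size_mset)
  then have k: "k = card {i. i < length ?ls \<and> ?ls ! i < 0}"
    by (simp add: length_filter_conv_card)
  have "{i. i < length ?ls \<and> ?ls ! i < 0} \<subseteq> {..<j}"
  proof (clarsimp simp: not_less)
    fix i assume "i < length ?ls" "?ls ! i < 0"
    then show "i < j"
      using \<open>\<not> ?ls ! j < 0\<close> sorted_nth_mono[OF sorted_sorted_list_of_multiset, of j i M]
      by (cases "i < j") auto
  qed
  then have "k \<le> j" using card_mono[of "{..<j}"] k by fastforce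
  with \<open>j < k\<close> show False by simp
qed

lemma size_negative_eigenvalues:
  fixes A :: "real^'n^'n"
  assumes "orthonormal_eigenbasis A u l"
  shows "size {#x \<in># eigenvalues A. x < 0#} = card {i. l i < 0}"
  by (simp add: eigenvalues_eigenbasis[OF assms] filter_mset_image_mset)

text \<open>The sum is the orthogonal projection onto the span of the \<open>v\<^sub>j\<close>, and that span is the negative
  eigenspace of \<open>B\<close>: the \<open>v\<^sub>j\<close> belong to negative eigenvalues, hence are orthogonal to every
  \<open>w\<^sub>i\<close> with \<open>b\<^sub>i \<ge> 0\<close>, and there are as many of them as the negative eigenspace has dimensions.\<close>
lemma lowest_eigenvectors_projection:
  fixes B :: "real^'n^'n"
  assumes symB: "transpose B = B" and wb: "orthonormal_eigenbasis B w b"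
    and k: "card {i. b i < 0} = k" and low: "lowest_eigenvectors B k v"
  shows "w i \<bullet> (\<Sum>j<k. (v j \<bullet> x) *\<^sub>R v j) = (if b i < 0 then w i \<bullet> x else 0)"
proof -
  note w = orthonormal_eigenbasisD[OF wb]
  let ?N = "{i. b i < 0}"
  define c where "c j = sorted_list_of_multiset (eigenvalues B) ! j" for j
  have v: "v i \<bullet> v j = (if i = j then 1 else 0)" if "i < k" "j < k" for i j
    using low that by (auto simp: lowest_eigenvectors_def)
  have ev: "B *v v j = c j *\<^sub>R v j" if "j < k" for j
    using low that by (auto simp: lowest_eigenvectors_def c_def)
  have neg: "c j < 0" if "j < k" for j
    unfolding c_def
    by (rule sorted_nth_negative[OF _ that]) (simp add: size_negative_eigenvalues[OF wb] k)
  have perp: "w i \<bullet> v j = 0" if "\<not> b i < 0" "j < k" for i j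
  proof -
    have "b i * (w i \<bullet> v j) = c j * (w i \<bullet> v j)"
      using eigenbasis_coordinate[OF symB wb, of i "v j"] ev[OF \<open>j < k\<close>] by auto
    then show ?thesis using neg[OF \<open>j < k\<close>] that by auto
  qed
  show ?thesis
  proof (cases "b i < 0")
    case False
    then show ?thesis by (simp add: inner_sum_right perp)
  next
    case True
    have indep: "independent (v ` {..<k})" and inj: "inj_on v {..<k}"
      using orthonormal_independent_inj[of "{..<k}" v] v by auto
    have "v j \<in> span (w ` ?N)" if "j < k" for j
    proof -
      have "v j = (\<Sum>i\<in>UNIV. (w i \<bullet> v j) *\<^sub>R w i)" by (rule orthonormal_expansion[OF w(1)])
      moreover have "(w i \<bullet> v j) *\<^sub>R w i \<in> span (w ` ?N)" for i
        using perp[OF _ that, of i] by (cases "b i < 0") (auto intro: span_mul span_base span_zero)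
      ultimately show ?thesis by (metis (no_types, lifting) span_sum)
    qed
    then have "v ` {..<k} \<subseteq> span (w ` ?N)" by auto
    moreover have "dim (span (w ` ?N)) \<le> card (v ` {..<k})"
      using orthonormal_independent_inj[of ?N w] w k inj
      by (simp add: dim_eq_card_independent card_image)
    ultimately have "span (w ` ?N) \<subseteq> span (v ` {..<k})"
      using card_ge_dim_independent[OF _ indep] by blast
    moreover have "w i \<in> span (w ` ?N)" using True by (auto intro: span_base)
    ultimately have "w i \<in> span (v ` {..<k})" by blast
    then obtain a where "w i = (\<Sum>y\<in>v ` {..<k}. a y *\<^sub>R y)"
      by (auto simp: span_finite)
    then have a: "w i = (\<Sum>j<k. a (v j) *\<^sub>R v j)"
      by (simp add: sum.reindex[OF inj])
    have "v j \<bullet> w i = a (v j)" if "j < k" for j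
    proof -
      have "v j \<bullet> w i = (\<Sum>j'<k. if j = j' then a (v j) else 0)"
        unfolding a inner_sum_right by (rule sum.cong) (auto simp: v that)
      then show ?thesis using that by simp
    qed
    then have "(\<Sum>j<k. (v j \<bullet> w i) *\<^sub>R v j) = w i" using a by simp
    moreover have "w i \<bullet> (\<Sum>j<k. (v j \<bullet> x) *\<^sub>R v j) = (\<Sum>j<k. (v j \<bullet> w i) *\<^sub>R v j) \<bullet> x"
      by (simp add: inner_sum_right inner_sum_left inner_commute mult.commute)
    ultimately show ?thesis using True by simp
  qed
qed

section \<open>Symmetry of the Hessian and Taylor expansion of the gradient\<close>

text \<open>The gradient and the Hessian are defined by description and by Jacobian matrices; here they are
  identified with the Frechet derivatives.\<close>
lemma twice_continuously_differentiable_derivs: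
  assumes "twice_continuously_differentiable E"
  shows "(E has_derivative (\<lambda>h. gradient E x \<bullet> h)) (at x)"
    and "(gradient E has_derivative (\<lambda>h. hessian E x *v h)) (at x)"
    and "continuous_on UNIV (hessian E)"
proof -
  have "E differentiable (at x)" using assms by (simp add: twice_continuously_differentiable_def)
  then obtain f where f: "(E has_derivative f) (at x)" by (auto simp: differentiable_def)
  then interpret f: bounded_linear f by (rule has_derivative_bounded_linear)
  have "f h = h \<bullet> (\<chi> i. f (axis i 1))" for h
  proof -
    have "f h = f (\<Sum>i\<in>UNIV. h $ i *s axis i 1)" by (simp add: basis_expansion)
    also have "\<dots> = (\<Sum>i\<in>UNIV. h $ i * f (axis i 1))"
      by (simp add: f.sum scalar_mult_eq_scaleR f.scaleR)
    finally show ?thesis by (simp add: inner_vec_def)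
  qed
  with f have D: "GDERIV E x :> (\<chi> i. f (axis i 1))"
    unfolding gderiv_def by (metis (no_types, lifting) ext)
  have "D = (\<chi> i. f (axis i 1))" if "GDERIV E x :> D" for D
  proof -
    have "(\<lambda>h. h \<bullet> D) = (\<lambda>h. h \<bullet> (\<chi> i. f (axis i 1)))"
      using that D unfolding gderiv_def by (rule has_derivative_unique)
    then show ?thesis by (metis vector_eq_ldot)
  qed
  with D have "GDERIV E x :> gradient E x"
    unfolding gradient_def by (rule theI)
  then show "(E has_derivative (\<lambda>h. gradient E x \<bullet> h)) (at x)"
    by (simp add: gderiv_def inner_commute)
  have "gradient E differentiable (at x)"
    using assms by (simp add: twice_continuously_differentiable_def)
  then show "(gradient E has_derivative (\<lambda>h. hessian E x *v h)) (at x)"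
    by (simp add: jacobian_works hessian_def)
  show "continuous_on UNIV (hessian E)"
    using assms by (simp add: twice_continuously_differentiable_def)
qed

text \<open>The mean value theorem is applied twice, first in direction \<open>q\<close> to
  \<open>\<tau> \<mapsto> E (x + t p + \<tau> q) - E (x + \<tau> q)\<close>, then in direction \<open>p\<close> to the derivative found.\<close>
lemma second_difference_mvt:
  fixes E :: "real^'n \<Rightarrow> real"
  assumes E: "twice_continuously_differentiable E" and "0 < t"
  obtains a b where "0 < a" "a < t" "0 < b" "b < t"
    "E (x + t *\<^sub>R p + t *\<^sub>R q) - E (x + t *\<^sub>R p) - E (x + t *\<^sub>R q) + E x
       = t\<^sup>2 * (q \<bullet> (hessian E (x + a *\<^sub>R p + b *\<^sub>R q) *v p))"
proof -
  note E1 = twice_continuously_differentiable_derivs(1)[OF E]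
  note E2 = twice_continuously_differentiable_derivs(2)[OF E]
  note d1 = has_derivative_compose[OF _ E1] and d2 = has_derivative_compose[OF _ E2]
  define \<phi> where "\<phi> \<tau> = E (x + t *\<^sub>R p + \<tau> *\<^sub>R q) - E (x + \<tau> *\<^sub>R q)" for \<tau>
  have d\<phi>: "(\<phi> has_derivative (\<lambda>h. h * ((gradient E (x + t *\<^sub>R p + \<tau> *\<^sub>R q)
      - gradient E (x + \<tau> *\<^sub>R q)) \<bullet> q))) (at \<tau>)" for \<tau>
    unfolding \<phi>_def
    by (auto intro!: derivative_eq_intros d1 simp: algebra_simps)
  obtain b where b: "0 < b" "b < t"
    and \<phi>: "\<phi> t - \<phi> 0 = t * ((gradient E (x + t *\<^sub>R p + b *\<^sub>R q) - gradient E (x + b *\<^sub>R q)) \<bullet> q)"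
    using mvt_simple[OF \<open>0 < t\<close> has_derivative_at_withinI[OF d\<phi>]] by auto
  define \<psi> where "\<psi> \<sigma> = gradient E (x + \<sigma> *\<^sub>R p + b *\<^sub>R q) \<bullet> q" for \<sigma>
  have d\<psi>: "(\<psi> has_derivative (\<lambda>h. h * ((hessian E (x + \<sigma> *\<^sub>R p + b *\<^sub>R q) *v p) \<bullet> q))) (at \<sigma>)" for \<sigma>
    unfolding \<psi>_def
    by (auto intro!: derivative_eq_intros d2 simp: matrix_vector_mult_scaleR)
  obtain a where a: "0 < a" "a < t"
    and \<psi>: "\<psi> t - \<psi> 0 = t * ((hessian E (x + a *\<^sub>R p + b *\<^sub>R q) *v p) \<bullet> q)"
    using mvt_simple[OF \<open>0 < t\<close> has_derivative_at_withinI[OF d\<psi>]] by auto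
  have "\<phi> t - \<phi> 0 = t * (\<psi> t - \<psi> 0)"
    unfolding \<phi> \<psi>_def by (simp add: inner_diff_left)
  with \<psi> have "\<phi> t - \<phi> 0 = t\<^sup>2 * (q \<bullet> (hessian E (x + a *\<^sub>R p + b *\<^sub>R q) *v p))"
    by (simp add: power2_eq_square inner_commute)
  with a b that show thesis by (simp add: \<phi>_def)
qed

text \<open>The second difference in directions \<open>p\<close> and \<open>q\<close> does not change when they are exchanged, and
  divided by \<open>t\<^sup>2\<close> it converges to \<open>q \<bullet> G p\<close> by continuity of \<open>G\<close>.\<close>
theorem hessian_symmetric:
  fixes E :: "real^'n \<Rightarrow> real"
  assumes E: "twice_continuously_differentiable E"
  shows "transpose (hessian E x) = hessian E x"
proof -
  define h where "h n = inverse (real (Suc n))" for n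
  have h: "0 < h n" for n by (simp add: h_def)
  have h0: "h \<longlonglongrightarrow> 0" unfolding h_def by (rule LIMSEQ_inverse_real_of_nat)
  define D where "D t p q = E (x + t *\<^sub>R p + t *\<^sub>R q) - E (x + t *\<^sub>R p) - E (x + t *\<^sub>R q) + E x"
    for t p q
  have lim: "(\<lambda>n. D (h n) p q / (h n)\<^sup>2) \<longlonglongrightarrow> q \<bullet> (hessian E x *v p)" for p q
  proof -
    define P where "P n a b \<longleftrightarrow> 0 < a \<and> a < h n \<and> 0 < b \<and> b < h n \<and>
      D (h n) p q / (h n)\<^sup>2 = q \<bullet> (hessian E (x + a *\<^sub>R p + b *\<^sub>R q) *v p)" for n a b
    have "\<exists>a b. P n a b" for n
    proof -
      obtain a b where "0 < a" "a < h n" "0 < b" "b < h n"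
        "D (h n) p q = (h n)\<^sup>2 * (q \<bullet> (hessian E (x + a *\<^sub>R p + b *\<^sub>R q) *v p))"
        using second_difference_mvt[OF E h] unfolding D_def by blast
      then have "P n a b" using h[of n] by (simp add: P_def)
      then show ?thesis by blast
    qed
    then obtain a b where P: "\<And>n. P n (a n) (b n)" by metis
    have "a \<longlonglongrightarrow> 0" "b \<longlonglongrightarrow> 0"
      by (rule tendsto_sandwich[OF _ _ tendsto_const h0]; use P in \<open>simp add: P_def less_imp_le\<close>)+
    then have "(\<lambda>n. x + a n *\<^sub>R p + b n *\<^sub>R q) \<longlonglongrightarrow> x + 0 *\<^sub>R p + 0 *\<^sub>R q"
      by (intro tendsto_intros)
    then have "(\<lambda>n. hessian E (x + a n *\<^sub>R p + b n *\<^sub>R q)) \<longlonglongrightarrow> hessian E x"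
      using continuous_on_tendsto_compose[OF twice_continuously_differentiable_derivs(3)[OF E]]
      by simp
    then have "(\<lambda>n. q \<bullet> (hessian E (x + a n *\<^sub>R p + b n *\<^sub>R q) *v p)) \<longlonglongrightarrow> q \<bullet> (hessian E x *v p)"
      unfolding matrix_vector_mult_def
      by (intro tendsto_inner tendsto_const vec_tendstoI)
        (auto intro!: tendsto_sum tendsto_mult tendsto_vec_nth)
    then show ?thesis using P by (simp add: P_def)
  qed
  have "D t p q = D t q p" for t p q by (simp add: D_def algebra_simps)
  then have sym: "q \<bullet> (hessian E x *v p) = p \<bullet> (hessian E x *v q)" for p q
    using LIMSEQ_unique[OF lim[of p q]] lim[of q p] by simp
  have "hessian E x $ i $ j = hessian E x $ j $ i" for i j
    using sym[of "axis i 1" "axis j 1"] 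
    by (simp add: inner_axis' matrix_vector_mult_basis column_def)
  then show ?thesis by (simp add: vec_eq_iff transpose_def)
qed

text \<open>The expansion is taken at \<open>x\<close>, not at \<open>xs\<close>, because the eigenvectors used by the iteration are
  those of \<open>G(x)\<close>.  Along the segment from \<open>xs\<close> to \<open>x\<close> the Hessian differs from \<open>G(x)\<close> by at most
  \<open>M (1 - t) \<parallel>x - xs\<parallel>\<close>; integrating over \<open>t\<close> produces the factor \<open>1/2\<close>.\<close>
lemma gradient_taylor_remainder:
  fixes E :: "real^'n \<Rightarrow> real"
  assumes E: "twice_continuously_differentiable E"
    and lip: "\<And>y z. y \<in> ball xs \<delta> \<Longrightarrow> z \<in> ball xs \<delta> \<Longrightarrow>
           matrix_norm2 (hessian E y - hessian E z) \<le> M * norm (y - z)"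
    and x: "x \<in> ball xs \<delta>"
  shows "norm (gradient E x - gradient E xs - hessian E x *v (x - xs)) \<le> M / 2 * (norm (x - xs))\<^sup>2"
proof -
  note E2 = twice_continuously_differentiable_derivs(2)[OF E]
  define e where "e = x - xs"
  \<comment> \<open>The remainder is \<open>f 1 - f 0\<close>, and \<open>\<phi>\<close> is the primitive of the bound for the derivative of \<open>f\<close>.\<close>
  define f where "f t = gradient E (xs + t *\<^sub>R e) - t *\<^sub>R (hessian E x *v e)" for t :: real
  define \<phi> where "\<phi> t = M * (norm e)\<^sup>2 * (t - t\<^sup>2 / 2)" for t :: real
  have df: "(f has_vector_derivative (hessian E (xs + t *\<^sub>R e) - hessian E x) *v e) (at t)" for t
    unfolding f_def has_vector_derivative_def
    by (auto intro!: derivative_eq_intros has_derivative_compose[OF _ E2]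
        simp: matrix_vector_mult_scaleR matrix_vector_mult_diff_rdistrib scaleR_diff_right)
  have d\<phi>: "(\<phi> has_vector_derivative M * (norm e)\<^sup>2 * (1 - t)) (at t)" for t
    unfolding \<phi>_def has_real_derivative_iff_has_vector_derivative[symmetric]
    by (auto intro!: derivative_eq_intros simp: algebra_simps)
  have bnd: "norm ((hessian E (xs + t *\<^sub>R e) - hessian E x) *v e) \<le> M * (norm e)\<^sup>2 * (1 - t)"
    if t: "0 < t" "t < 1" for t
  proof -
    have "norm (t *\<^sub>R e) \<le> norm e" using t by (simp add: mult_left_le_one_le)
    then have "xs + t *\<^sub>R e \<in> ball xs \<delta>"
      using x by (simp add: dist_norm e_def norm_minus_commute)
    then have "matrix_norm2 (hessian E (xs + t *\<^sub>R e) - hessian E x) \<le> M * norm (xs + t *\<^sub>R e - x)"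
      using x by (rule lip)
    also have "xs + t *\<^sub>R e - x = - (1 - t) *\<^sub>R e" by (simp add: e_def algebra_simps)
    also have "norm \<dots> = (1 - t) * norm e" using t by simp
    finally have "matrix_norm2 (hessian E (xs + t *\<^sub>R e) - hessian E x) * norm e
        \<le> M * ((1 - t) * norm e) * norm e"
      by (rule mult_right_mono) simp
    moreover have "norm ((hessian E (xs + t *\<^sub>R e) - hessian E x) *v e)
        \<le> matrix_norm2 (hessian E (xs + t *\<^sub>R e) - hessian E x) * norm e"
      unfolding matrix_norm2_def by (rule onorm) simp
    ultimately show ?thesis by (simp add: power2_eq_square mult_ac)
  qed
  have "continuous_on {0..1} f" "continuous_on {0..1} \<phi>"
    using df d\<phi> by (meson continuous_at_imp_continuous_on has_vector_derivative_continuous)+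
  from differentiable_bound_general[OF _ this df d\<phi> bnd] have "norm (f 1 - f 0) \<le> \<phi> 1 - \<phi> 0"
    by simp
  then show ?thesis by (simp add: f_def \<phi>_def e_def algebra_simps)
qed

section \<open>One step of the iteration\<close>

text \<open>The linear map that turns the gradient into the search direction.  Splitting it off allows it to
  be applied separately to the linear part of the gradient and to the remainder.\<close>
definition ihisd_operator ::
  "nat \<Rightarrow> real \<Rightarrow> real \<Rightarrow> (nat \<Rightarrow> real^'n) \<Rightarrow> real^'n \<Rightarrow> real^'n" where
  "ihisd_operator k s a v y =
     ((1 - a) * s - a) *\<^sub>R y + (2 * a) *\<^sub>R (\<Sum>i<k. (v i \<bullet> y) *\<^sub>R v i)"

lemma ihisd_direction_eq_operator:
  "ihisd_direction E k s a v x = ihisd_operator k s a v (gradient E x)"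
  by (simp add: ihisd_direction_def ihisd_operator_def)

lemma ihisd_operator_add:
  "ihisd_operator k s a v (y + z) = ihisd_operator k s a v y + ihisd_operator k s a v z"
  by (simp add: ihisd_operator_def inner_add_right scaleR_add_left scaleR_add_right sum.distrib)

text \<open>On the negative eigenspace the scalar is \<open>1\<close> or \<open>2 a - 1\<close>, on the complement it is \<open>1 - 2 a\<close> or
  \<open>-1\<close>, according to \<open>s = 1\<close> or \<open>s = -1\<close>.\<close>
lemma ihisd_operator_coordinate:
  fixes B :: "real^'n^'n"
  assumes symB: "transpose B = B" and wb: "orthonormal_eigenbasis B w b"
    and k: "card {i. b i < 0} = k" and low: "lowest_eigenvectors B k v"
  shows "w i \<bullet> ihisd_operator k s a v y = (if b i < 0 then (1 - a) * s + a else (1 - a) * s - a) * (w i \<bullet> y)"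
  by (simp add: ihisd_operator_def lowest_eigenvectors_projection[OF symB wb k low] algebra_simps)

lemma ihisd_operator_norm_le:
  fixes B :: "real^'n^'n"
  assumes symB: "transpose B = B" and wb: "orthonormal_eigenbasis B w b"
    and k: "card {i. b i < 0} = k" and low: "lowest_eigenvectors B k v"
    and s: "s \<in> {1, -1}" and a: "1 / 2 \<le> a" "a \<le> 1"
  shows "norm (ihisd_operator k s a v y) \<le> norm y"
proof -
  have "\<bar>if b i < 0 then (1 - a) * s + a else (1 - a) * s - a\<bar> \<le> 1" for i
    using s a by auto
  then have "\<bar>w i \<bullet> ihisd_operator k s a v y\<bar> \<le> 1 * \<bar>w i \<bullet> y\<bar>" for i
    unfolding ihisd_operator_coordinate[OF symB wb k low] abs_mult
    by (intro mult_right_mono) auto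
  from norm_le_by_coordinates[OF orthonormal_eigenbasisD(1)[OF wb] this] show ?thesis by simp
qed

text \<open>The map \<open>t \<mapsto> \<bar>1 - \<eta> t\<bar>\<close> is convex, so it is largest at the ends of the interval.  For \<open>\<rho> = 0\<close> the
  ends \<open>\<mu> \<beta>\<close> and \<open>L\<close> give the same value, by the choice of \<open>\<eta>\<close>; moving them outwards by
  \<open>\<beta> \<rho> \<le> \<rho>\<close> and \<open>\<rho>\<close> adds at most \<open>\<eta> \<rho>\<close>.\<close>
lemma balanced_step_contraction:
  fixes \<beta> \<mu> L \<rho> t :: real
  assumes "0 < \<beta>" "\<beta> \<le> 1" "0 < \<mu>" "\<mu> \<le> L" "0 \<le> \<rho>"
    and t: "\<beta> * (\<mu> - \<rho>) \<le> t" "t \<le> L + \<rho>"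
  shows "\<bar>1 - 2 / (L + \<mu> * \<beta>) * t\<bar> \<le> (L - \<mu> * \<beta> + 2 * \<rho>) / (L + \<mu> * \<beta>)"
proof -
  have pos: "0 < L + \<mu> * \<beta>" using assms by (simp add: add_pos_pos)
  have "\<beta> * \<rho> \<le> \<rho>" using assms by (simp add: mult_left_le_one_le)
  then have "\<bar>L + \<mu> * \<beta> - 2 * t\<bar> \<le> L - \<mu> * \<beta> + 2 * \<rho>"
    using t by (auto simp: abs_le_iff algebra_simps)
  then have "\<bar>L + \<mu> * \<beta> - 2 * t\<bar> / (L + \<mu> * \<beta>) \<le> (L - \<mu> * \<beta> + 2 * \<rho>) / (L + \<mu> * \<beta>)"
    using pos by (simp add: divide_right_mono)
  moreover have "1 - 2 / (L + \<mu> * \<beta>) * t = (L + \<mu> * \<beta> - 2 * t) / (L + \<mu> * \<beta>)"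
    using pos by (simp add: field_simps)
  ultimately show ?thesis using pos by simp
qed

text \<open>The operator is diagonal in the eigenbasis of \<open>B\<close>.  Its sign pattern is opposite to that of
  the eigenvalues, so each coordinate of \<open>e\<close> is multiplied by \<open>1 - \<eta> \<bar>\<sigma>\<bar> \<bar>b\<^sub>i\<bar>\<close> with
  \<open>2 a - 1 \<le> \<bar>\<sigma>\<bar> \<le> 1\<close>.\<close>
lemma ihisd_linear_step:
  fixes B :: "real^'n^'n"
  assumes symB: "transpose B = B" and wb: "orthonormal_eigenbasis B w b"
    and k: "card {i. b i < 0} = k" and low: "lowest_eigenvectors B k v"
    and s: "s \<in> {1, -1}" and a: "1 / 2 < a" "a \<le> 1"
    and \<mu>: "0 < \<mu>" "\<mu> \<le> L" and \<rho>: "0 \<le> \<rho>" "\<rho> \<le> \<mu>"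
    and bounds: "\<And>i. \<mu> - \<rho> \<le> \<bar>b i\<bar>" "\<And>i. \<bar>b i\<bar> \<le> L + \<rho>"
  shows "norm (e + (2 / (L + \<mu> * (2 * a - 1))) *\<^sub>R ihisd_operator k s a v (B *v e))
    \<le> (L - \<mu> * (2 * a - 1) + 2 * \<rho>) / (L + \<mu> * (2 * a - 1)) * norm e"
proof (rule norm_le_by_coordinates[OF orthonormal_eigenbasisD(1)[OF wb]])
  let ?\<eta> = "2 / (L + \<mu> * (2 * a - 1))"
  have \<beta>: "0 < 2 * a - 1" "2 * a - 1 \<le> 1" using a by auto
  have "\<mu> * (2 * a - 1) \<le> \<mu>" using \<beta> \<mu> by (simp add: mult_left_le)
  then have "0 \<le> L - \<mu> * (2 * a - 1) + 2 * \<rho>" using \<mu> \<rho> by linarith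
  then show "0 \<le> (L - \<mu> * (2 * a - 1) + 2 * \<rho>) / (L + \<mu> * (2 * a - 1))"
    using \<mu> \<beta> by (intro divide_nonneg_pos add_pos_pos mult_pos_pos) auto
  fix i
  define \<sigma> where "\<sigma> = (if b i < 0 then (1 - a) * s + a else (1 - a) * s - a)"
  have \<sigma>: "2 * a - 1 \<le> \<bar>\<sigma>\<bar>" "\<bar>\<sigma>\<bar> \<le> 1" "\<sigma> * b i = - (\<bar>\<sigma>\<bar> * \<bar>b i\<bar>)"
    using s a by (auto simp: \<sigma>_def algebra_simps)
  have "(2 * a - 1) * (\<mu> - \<rho>) \<le> \<bar>\<sigma>\<bar> * \<bar>b i\<bar>"
    using \<sigma>(1) bounds(1)[of i] \<beta> \<rho> by (intro mult_mono) auto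
  moreover have "\<bar>\<sigma>\<bar> * \<bar>b i\<bar> \<le> L + \<rho>"
    using mult_left_le_one_le[of "\<bar>b i\<bar>" "\<bar>\<sigma>\<bar>"] \<sigma>(2) bounds(2)[of i] by linarith
  ultimately have "\<bar>1 - ?\<eta> * (\<bar>\<sigma>\<bar> * \<bar>b i\<bar>)\<bar> \<le> (L - \<mu> * (2 * a - 1) + 2 * \<rho>) / (L + \<mu> * (2 * a - 1))"
    using \<beta> \<mu> \<rho>(1) by (intro balanced_step_contraction) auto
  moreover have "w i \<bullet> (e + ?\<eta> *\<^sub>R ihisd_operator k s a v (B *v e))
      = (1 - ?\<eta> * (\<bar>\<sigma>\<bar> * \<bar>b i\<bar>)) * (w i \<bullet> e)"
  proof -
    have "w i \<bullet> ihisd_operator k s a v (B *v e) = (\<sigma> * b i) * (w i \<bullet> e)"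
      by (simp add: ihisd_operator_coordinate[OF symB wb k low]
          eigenbasis_coordinate[OF symB wb] \<sigma>_def)
    then show ?thesis unfolding \<sigma>(3) by (simp add: inner_add_right algebra_simps)
  qed
  ultimately show "\<bar>w i \<bullet> (e + ?\<eta> *\<^sub>R ihisd_operator k s a v (B *v e))\<bar>
      \<le> (L - \<mu> * (2 * a - 1) + 2 * \<rho>) / (L + \<mu> * (2 * a - 1)) * \<bar>w i \<bullet> e\<bar>"
    by (simp only: abs_mult mult_right_mono abs_ge_zero)
qed

text \<open>Of the \<open>3 M r\<close> in the factor, \<open>2 M r\<close> is due to the perturbed eigenvalues of the Hessian at \<open>x\<close>
  and \<open>M r\<close> to the Taylor remainder of the gradient.\<close>
lemma ihisd_step_error:
  fixes E :: "real^'n \<Rightarrow> real"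
  assumes E: "twice_continuously_differentiable E" and saddle: "k_saddle k E xs"
    and \<mu>: "0 < \<mu>" "\<mu> \<le> lambda_min (matrix_abs (hessian E xs))"
    and L: "lambda_max (matrix_abs (hessian E xs)) \<le> L"
    and "0 \<le> M"
    and lip: "\<And>y z. y \<in> ball xs \<delta> \<Longrightarrow> z \<in> ball xs \<delta> \<Longrightarrow>
           matrix_norm2 (hessian E y - hessian E z) \<le> M * norm (y - z)"
    and s: "s \<in> {1, -1}" and a: "1 / 2 < a" "a \<le> 1"
    and near: "norm (x - xs) < \<delta>" "M * norm (x - xs) < \<mu>"
    and low: "lowest_eigenvectors (hessian E x) k v"
  shows "norm (x + (2 / (L + \<mu> * (2 * a - 1))) *\<^sub>R ihisd_direction E k s a v x - xs)
    \<le> (L - \<mu> * (2 * a - 1) + 3 * (M * norm (x - xs))) / (L + \<mu> * (2 * a - 1)) * norm (x - xs)"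
proof -
  define e where "e = x - xs"
  define \<eta> where "\<eta> = 2 / (L + \<mu> * (2 * a - 1))"
  note symA = hessian_symmetric[OF E, of xs] and symB = hessian_symmetric[OF E, of x]
  obtain u l where ul: "orthonormal_eigenbasis (hessian E xs) u l"
    using symmetric_orthonormal_eigenbasis[OF symA] .
  obtain w b where wb: "orthonormal_eigenbasis (hessian E x) w b"
    using symmetric_orthonormal_eigenbasis[OF symB] .
  have l: "\<mu> \<le> \<bar>l i\<bar>" "\<bar>l i\<bar> \<le> L" for i
    using eigenbasis_abs_bounds[OF ul, of i] \<mu>(2) L by auto
  then have \<mu>L: "\<mu> \<le> L" by (meson order_trans)
  have in_ball: "x \<in> ball xs \<delta>" "xs \<in> ball xs \<delta>"
    using near(1) by (auto simp: dist_norm norm_minus_commute dest: order_le_less_trans[OF norm_ge_zero])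
  have close: "norm (hessian E x *v y - hessian E xs *v y) \<le> M * norm e * norm y" for y
  proof -
    have "norm ((hessian E x - hessian E xs) *v y) \<le> matrix_norm2 (hessian E x - hessian E xs) * norm y"
      unfolding matrix_norm2_def by (rule onorm) simp
    also have "\<dots> \<le> M * norm e * norm y"
      using lip[OF in_ball] by (simp add: e_def mult_right_mono)
    finally show ?thesis by (simp add: matrix_vector_mult_diff_rdistrib)
  qed
  have \<rho>: "0 \<le> M * norm e" "M * norm e < \<mu>" using \<open>0 \<le> M\<close> near(2) by (auto simp: e_def)
  note b = perturbed_eigenvalues[OF symA ul symB wb l close \<rho>]
  have k: "card {i. b i < 0} = k"
    using b(3) saddle by (simp add: k_saddle_def size_negative_eigenvalues[OF ul])
  define R where "R = gradient E x - hessian E x *v e"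
  have R: "norm R \<le> M / 2 * (norm e)\<^sup>2"
    using gradient_taylor_remainder[OF E lip in_ball(1)] saddle by (simp add: R_def e_def k_saddle_def)
  have pos: "0 < L + \<mu> * (2 * a - 1)" using \<mu> \<mu>L a by (intro add_pos_pos mult_pos_pos) auto
  then have \<eta>: "0 \<le> \<eta>" by (simp add: \<eta>_def)
  let ?D = "ihisd_operator k s a v"
  have "gradient E x = hessian E x *v e + R" by (simp add: R_def)
  then have "x + \<eta> *\<^sub>R ihisd_direction E k s a v x - xs = (e + \<eta> *\<^sub>R ?D (hessian E x *v e)) + \<eta> *\<^sub>R ?D R"
    by (simp add: ihisd_direction_eq_operator ihisd_operator_add e_def scaleR_add_right)
  then have "norm (x + \<eta> *\<^sub>R ihisd_direction E k s a v x - xs)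
      \<le> norm (e + \<eta> *\<^sub>R ?D (hessian E x *v e)) + norm (\<eta> *\<^sub>R ?D R)"
    by (simp only: norm_triangle_ineq)
  also have "\<dots> \<le> (L - \<mu> * (2 * a - 1) + 2 * (M * norm e)) / (L + \<mu> * (2 * a - 1)) * norm e
      + \<eta> * (M / 2 * (norm e)\<^sup>2)"
  proof (rule add_mono)
    show "norm (e + \<eta> *\<^sub>R ?D (hessian E x *v e))
        \<le> (L - \<mu> * (2 * a - 1) + 2 * (M * norm e)) / (L + \<mu> * (2 * a - 1)) * norm e"
      unfolding \<eta>_def using \<mu>(1) \<mu>L \<rho> b(1,2)
      by (intro ihisd_linear_step[OF symB wb k low s a]) auto
    have "norm (?D R) \<le> M / 2 * (norm e)\<^sup>2"
      using ihisd_operator_norm_le[OF symB wb k low s, of a R] a R by simp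
    then show "norm (\<eta> *\<^sub>R ?D R) \<le> \<eta> * (M / 2 * (norm e)\<^sup>2)"
      using \<eta> by (simp only: norm_scaleR abs_of_nonneg mult_left_mono)
  qed
  also have "\<dots> = (L - \<mu> * (2 * a - 1) + 3 * (M * norm e)) / (L + \<mu> * (2 * a - 1)) * norm e"
    using pos by (simp add: \<eta>_def divide_simps power2_eq_square) (simp add: algebra_simps)
  finally show ?thesis by (simp add: \<eta>_def e_def)
qed

section \<open>Convergence rate\<close>

text \<open>A rate that holds from \<open>N\<close> on only costs the constant factor \<open>q\<^sup>-\<^sup>N\<close>, since \<open>q\<^sup>n\<^sup>-\<^sup>N \<ge> 1\<close> before \<open>N\<close>.\<close>
lemma eventual_rate_imp_linear_convergence:
  fixes f :: "nat \<Rightarrow> real"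
  assumes nonneg: "\<And>n. 0 \<le> f n" and bounded: "\<And>n. f n \<le> c" and q: "0 < q" "q \<le> 1"
    and step: "\<And>n. n \<ge> N \<Longrightarrow> f (Suc n) \<le> q * f n"
  shows "f n \<le> c / q ^ N * q ^ n"
proof (induction n)
  case 0
  have "f 0 * q ^ N \<le> c"
    using mult_left_le[of "q ^ N" "f 0"] nonneg bounded[of 0] q by (simp add: power_le_one)
  then show ?case using q by (simp add: field_simps)
next
  case (Suc n)
  show ?case
  proof (cases "N \<le> n")
    case True
    from step[OF this] have "f (Suc n) \<le> q * f n" .
    also have "\<dots> \<le> q * (c / q ^ N * q ^ n)" using Suc.IH q by (intro mult_left_mono) auto
    finally show ?thesis by (simp add: mult_ac)
  next
    case False
    have "0 \<le> c" using nonneg bounded order_trans by blast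
    moreover have "q ^ N \<le> q ^ Suc n" using False q by (intro power_decreasing) auto
    ultimately have "c * q ^ N \<le> c * q ^ Suc n" by (rule mult_left_mono[rotated])
    then have "c \<le> c / q ^ N * q ^ Suc n" using q by (simp add: field_simps)
    then show ?thesis using bounded[of "Suc n"] by linarith
  qed
qed

text \<open>The contraction factor \<open>p + c f\<close> is below \<open>1\<close> at the start and decreases with \<open>f\<close>, so \<open>f\<close> tends to
  \<open>0\<close> at least geometrically.  Hence the factor tends to \<open>p\<close>, and every \<open>q > p\<close> is eventually
  a valid rate.  The step inequality is assumed only below the initial value, since in the
  application it is available only near the limit.\<close>
lemma quadratically_perturbed_contraction:
  fixes f :: "nat \<Rightarrow> real"
  assumes nonneg: "\<And>n. 0 \<le> f n"
    and step: "\<And>n. f n \<le> f 0 \<Longrightarrow> f (Suc n) \<le> (p + c * f n) * f n"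
    and p: "0 \<le> p" "p < q" "q \<le> 1" and c: "0 \<le> c" and start: "p + c * f 0 < 1"
  shows "f \<longlonglongrightarrow> 0" and "\<exists>C\<ge>0. \<forall>n. f n \<le> C * q ^ n"
proof -
  let ?q0 = "p + c * f 0"
  have q0: "0 \<le> ?q0" "?q0 < 1" using assms by auto
  have geom: "f n \<le> f 0 * ?q0 ^ n" for n
  proof (induction n)
    case (Suc n)
    have "f 0 * ?q0 ^ n \<le> f 0" using q0 nonneg by (simp add: mult_left_le power_le_one)
    with Suc have le: "f n \<le> f 0" by linarith
    have "f (Suc n) \<le> (p + c * f n) * f n" by (rule step[OF le])
    also have "\<dots> \<le> ?q0 * (f 0 * ?q0 ^ n)"
      using Suc le c p nonneg q0 by (intro mult_mono) (auto intro: mult_left_mono)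
    finally show ?case by (simp add: mult_ac)
  qed simp
  have le0: "f n \<le> f 0" for n
  proof -
    have "f 0 * ?q0 ^ n \<le> f 0" using q0 nonneg by (simp add: mult_left_le power_le_one)
    with geom[of n] show ?thesis by linarith
  qed
  have "(\<lambda>n. f 0 * ?q0 ^ n) \<longlonglongrightarrow> f 0 * 0"
    using q0 by (intro tendsto_mult tendsto_const LIMSEQ_power_zero) simp
  then show lim: "f \<longlonglongrightarrow> 0"
    using tendsto_sandwich[OF always_eventually always_eventually tendsto_const] nonneg geom
    by (metis (no_types, lifting) mult_zero_right)
  have "(\<lambda>n. p + c * f n) \<longlonglongrightarrow> p + c * 0"
    by (intro tendsto_intros lim)
  then have "\<forall>\<^sub>F n in sequentially. p + c * f n < q"
    using order_tendstoD(2)[of _ p] p by simp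
  then obtain N where N: "\<And>n. n \<ge> N \<Longrightarrow> p + c * f n < q"
    by (auto simp: eventually_sequentially)
  have "f n \<le> f 0 / q ^ N * q ^ n" for n
  proof (rule eventual_rate_imp_linear_convergence[OF nonneg le0])
    fix n assume "N \<le> n"
    have "f (Suc n) \<le> (p + c * f n) * f n" by (rule step[OF le0])
    also have "\<dots> \<le> q * f n"
      using N[OF \<open>N \<le> n\<close>] nonneg by (intro mult_right_mono) auto
    finally show "f (Suc n) \<le> q * f n" .
  qed (use p in auto)
  moreover have "0 \<le> f 0 / q ^ N" using nonneg p by simp
  ultimately show "\<exists>C\<ge>0. \<forall>n. f n \<le> C * q ^ n" by blast
qed

theorem theorem4p1:
  fixes E :: "real^'n \<Rightarrow> real"
    and xs :: "real^'n"
    and k m\<^sub>0 :: nat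
    and \<mu> L \<delta> M s \<epsilon> \<kappa> :: real
    and \<alpha> \<eta> :: "nat \<Rightarrow> real"
    and x :: "nat \<Rightarrow> real^'n"
  assumes "twice_continuously_differentiable E"
    and "k_saddle k E xs"
    and "0 < \<mu>"
    and "\<mu> \<le> lambda_min (matrix_abs (hessian E xs))"
    and "lambda_max (matrix_abs (hessian E xs)) \<le> L"
    and "0 < \<delta>" and "0 < M"
    and "\<And>y z. y \<in> ball xs \<delta> \<Longrightarrow> z \<in> ball xs \<delta> \<Longrightarrow>
           matrix_norm2 (hessian E y - hessian E z) \<le> M * norm (y - z)"
    and "s \<in> {1, -1}"
    and "\<And>m. \<alpha> m \<in> {0..1}"
    and "ihisd_iteration E k s \<alpha> \<eta> x"
    and "0 < \<epsilon>" and "\<epsilon> < 1"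
    and "\<And>m. m \<ge> m\<^sub>0 \<Longrightarrow> \<alpha> m \<ge> (1 + \<epsilon>) / 2"
    and "norm (x m\<^sub>0 - xs) < min \<delta> (2 * \<mu> * \<epsilon> / (3 * M))"
    and "\<And>m. m \<ge> m\<^sub>0 \<Longrightarrow> \<eta> m = 2 / (L + \<mu> * (2 * \<alpha> m - 1))"
    and "\<kappa> = L / \<mu>"
  shows "x \<longlonglongrightarrow> xs \<and>
    (\<exists>C\<ge>0. \<forall>m\<ge>m\<^sub>0.
       norm (x m - xs) \<le> C * ((\<kappa> + \<epsilon>) / (\<kappa> + 3 * \<epsilon>)) ^ (m - m\<^sub>0))"
proof -
  define f where "f n = norm (x (m\<^sub>0 + n) - xs)" for n
  have nonneg: "0 \<le> f n" for n by (simp add: f_def)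
  obtain u l where ul: "orthonormal_eigenbasis (hessian E xs) u l"
    using symmetric_orthonormal_eigenbasis[OF hessian_symmetric[OF assms(1)]] .
  have \<mu>L: "\<mu> \<le> L"
    using eigenbasis_abs_bounds[OF ul] \<open>\<mu> \<le> _\<close> \<open>_ \<le> L\<close> by (meson order_trans)
  have \<mu>\<epsilon>: "0 < \<mu> * \<epsilon>" "\<mu> * \<epsilon> < \<mu>" using \<open>0 < \<mu>\<close> \<open>0 < \<epsilon>\<close> \<open>\<epsilon> < 1\<close> by simp_all
  have start: "f 0 < \<delta>" "3 * (M * f 0) < 2 * (\<mu> * \<epsilon>)"
    using assms(15) \<open>0 < M\<close> by (simp_all add: f_def field_simps)
  let ?p = "(L - \<mu> * \<epsilon>) / (L + \<mu> * \<epsilon>)" and ?c = "3 * M / (L + \<mu> * \<epsilon>)"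
    and ?q = "(\<kappa> + \<epsilon>) / (\<kappa> + 3 * \<epsilon>)"
  have rate: "?q = (L + \<mu> * \<epsilon>) / (L + 3 * (\<mu> * \<epsilon>))"
  proof -
    have "L + \<mu> * \<epsilon> = \<mu> * (\<kappa> + \<epsilon>)" "L + 3 * (\<mu> * \<epsilon>) = \<mu> * (\<kappa> + 3 * \<epsilon>)"
      using \<open>0 < \<mu>\<close> \<open>\<kappa> = L / \<mu>\<close> by (simp_all add: distrib_left)
    then show ?thesis using \<open>0 < \<mu>\<close> by simp
  qed
  have step: "f (Suc n) \<le> (?p + ?c * f n) * f n" if le: "f n \<le> f 0" for n
  proof -
    let ?m = "m\<^sub>0 + n"
    let ?\<beta> = "2 * \<alpha> ?m - 1"
    obtain v where v: "lowest_eigenvectors (hessian E (x ?m)) k v"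
      and x: "x (Suc ?m) = x ?m + \<eta> ?m *\<^sub>R ihisd_direction E k s (\<alpha> ?m) v (x ?m)"
      using assms(11) by (auto simp: ihisd_iteration_def)
    have \<alpha>: "(1 + \<epsilon>) / 2 \<le> \<alpha> ?m" "\<alpha> ?m \<le> 1" using assms(10)[of ?m] assms(14)[of ?m] by auto
    have "M * f n \<le> M * f 0" using le \<open>0 < M\<close> by simp
    then have Mf: "M * f n < \<mu>" using start(2) \<mu>\<epsilon> by linarith
    have "f (Suc n) \<le> (L - \<mu> * ?\<beta> + 3 * (M * f n)) / (L + \<mu> * ?\<beta>) * f n"
      using ihisd_step_error[OF assms(1-5) less_imp_le[OF \<open>0 < M\<close>] assms(8) \<open>s \<in> {1, -1}\<close> _ \<alpha>(2) _ _ v]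
        \<alpha>(1) \<open>0 < \<epsilon>\<close> le start(1) Mf assms(16)[of ?m]
      by (simp add: f_def x)
    \<comment> \<open>The factor is antitone in \<open>\<beta>\<close>, and \<open>\<beta> \<ge> \<epsilon>\<close>.\<close>
    also have "\<dots> \<le> (L - \<mu> * \<epsilon> + 3 * (M * f n)) / (L + \<mu> * \<epsilon>) * f n"
    proof (intro mult_right_mono nonneg frac_le)
      have "\<mu> * \<epsilon> \<le> \<mu> * ?\<beta>" using \<alpha>(1) \<open>0 < \<mu>\<close> by simp
      then show "L - \<mu> * ?\<beta> + 3 * (M * f n) \<le> L - \<mu> * \<epsilon> + 3 * (M * f n)"
        "L + \<mu> * \<epsilon> \<le> L + \<mu> * ?\<beta>" by linarith+
      show "0 \<le> L - \<mu> * \<epsilon> + 3 * (M * f n)" "0 < L + \<mu> * \<epsilon>"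
        using \<mu>L \<mu>\<epsilon> nonneg[of n] \<open>0 < M\<close> by (auto intro!: add_nonneg_nonneg)
    qed
    also have "\<dots> = (?p + ?c * f n) * f n" by (simp add: add_divide_distrib)
    finally show ?thesis .
  qed
  have pos: "0 < L + \<mu> * \<epsilon>" "0 < L + 3 * (\<mu> * \<epsilon>)" "0 \<le> L - \<mu> * \<epsilon>"
    using \<mu>L \<mu>\<epsilon> by linarith+
  have "0 \<le> ?p" "0 \<le> ?c" using pos \<open>0 < M\<close> by simp_all
  moreover have "?p < ?q"
  proof -
    \<comment> \<open>The two sides differ by \<open>4 (\<mu> \<epsilon>)\<^sup>2\<close>.\<close>
    have "(L - \<mu> * \<epsilon>) * (L + 3 * (\<mu> * \<epsilon>)) < (L + \<mu> * \<epsilon>) * (L + \<mu> * \<epsilon>)"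
      using \<mu>\<epsilon>(1) mult_pos_pos[OF \<mu>\<epsilon>(1) \<mu>\<epsilon>(1)] by (simp add: algebra_simps)
    then show ?thesis unfolding rate using pos by (simp add: divide_less_eq less_divide_eq mult.commute)
  qed
  moreover have "?q \<le> 1" unfolding rate using pos \<open>0 < \<mu>\<close> \<open>0 < \<epsilon>\<close> by simp
  moreover have "?p + ?c * f 0 < 1"
  proof -
    have "?p + ?c * f 0 = (L - \<mu> * \<epsilon> + 3 * (M * f 0)) / (L + \<mu> * \<epsilon>)"
      by (simp add: add_divide_distrib)
    also have "\<dots> < 1" using start(2) pos by (subst divide_less_eq_1_pos) linarith+
    finally show ?thesis .
  qed
  ultimately have f0: "f \<longlonglongrightarrow> 0" and rate: "\<exists>C\<ge>0. \<forall>n. f n \<le> C * ?q ^ n"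
    using quadratically_perturbed_contraction[of f ?p ?c ?q, OF nonneg step] by blast+
  have "(\<lambda>n. norm (x (n + m\<^sub>0) - xs)) \<longlonglongrightarrow> 0"
    using f0 by (simp add: f_def[abs_def] add.commute)
  then have "(\<lambda>n. x (n + m\<^sub>0)) \<longlonglongrightarrow> xs"
    by (rule LIM_zero_cancel[OF tendsto_norm_zero_cancel])
  then have "x \<longlonglongrightarrow> xs" by (rule LIMSEQ_offset)
  moreover obtain C where C: "C \<ge> 0" "\<And>n. f n \<le> C * ?q ^ n" using rate by blast
  have "norm (x m - xs) \<le> C * ?q ^ (m - m\<^sub>0)" if "m \<ge> m\<^sub>0" for m
    using C(2)[of "m - m\<^sub>0"] that by (simp add: f_def)
  with C(1) have "\<exists>C\<ge>0. \<forall>m\<ge>m\<^sub>0. norm (x m - xs) \<le> C * ?q ^ (m - m\<^sub>0)" by blast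
  ultimately show ?thesis by blast
qed

end
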